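(* Let $r,s\ge1$, $d=r+s$, let $m_1,\dots,m_r,n_1,\dots,n_s$ be positive integers, and let $\mathcal{A}\in\mathbb{R}^{m_1\times\cdots\times m_r\times n_1\times\cdots\times n_s}$ be a hypermatrix of order $d$. Let ${\bf m}=\prod_{k=1}^r m_k$ and ${\bf n}=\prod_{k=1}^s n_k$. Then there exist $\mathcal{B}\in\mathbb{R}^{m_1\times\cdots\times m_r}$ and $\mathcal{C}\in\mathbb{R}^{n_1\times\cdots\times n_s}$ such that $\mathcal{A}=\mathcal{B}\circledcirc\mathcal{C}$ if and only if the vector $V(\mathcal{A})\in\mathbb{R}^{{\bf m}{\bf n}}$ is decomposable with respect to ${\bf m}\times{\bf n}$, i.e. there exist $y\in\mathbb{R}^{{\bf m}}$ and $z\in\mathbb{R}^{{\bf n}}$ with $V(\mathcal{A})=y\otimes z$.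
   Context: A hypermatrix in $\mathbb{R}^{q_1\times\cdots\times q_d}$ is a family of reals $(a_{k_1,\dots,k_d})$ with $1\le k_t\le q_t$; its vector form $V(\mathcal{A})$ is the column vector of its entries in lexicographic order of $(k_1,\dots,k_d)$ (last index varying fastest). Outer (Kronecker) product: for $\mathcal{B}=(b_{i_1,\dots,i_r})\in\mathbb{R}^{m_1\times\cdots\times m_r}$ and $\mathcal{C}=(c_{j_1,\dots,j_s})\in\mathbb{R}^{n_1\times\cdots\times n_s}$, $\mathcal{B}\circledcirc\mathcal{C}\in\mathbb{R}^{m_1\times\cdots\times m_r\times n_1\times\cdots\times n_s}$ has $(i_1,\dots,i_r,j_1,\dots,j_s)$ entry $b_{i_1,\dots,i_r}c_{j_1,\dots,j_s}$. $\otimes$ is the Kronecker product. *)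

theory Defs
  imports "Jordan_Normal_Form.Matrix" "HOL-Library.FuncSet" "HOL-Library.List_Lexorder"
begin

text \<open>Multi-indices are 1-based lists \<open>[k\<^sub>1, \<dots>, k\<^sub>d]\<close> with \<open>1 \<le> k\<^sub>t \<le> q\<^sub>t\<close>.\<close>

definition multi_indices :: "nat list \<Rightarrow> nat list set" where
  "multi_indices qs = listset (map (\<lambda>q. {1..q}) qs)"

text \<open>Extensional functions are used so that equality of hypermatrices of the same
  format is HOL equality.\<close>

definition hypermatrices :: "nat list \<Rightarrow> (nat list \<Rightarrow> real) set" where
  "hypermatrices qs = (multi_indices qs \<rightarrow>\<^sub>E UNIV)"

text \<open>The order on lists of naturals is the lexicographic one of
  \<^theory>\<open>HOL-Library.List_Lexorder\<close>.\<close>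

definition vector_form :: "nat list \<Rightarrow> (nat list \<Rightarrow> real) \<Rightarrow> real vec" where
  "vector_form qs A = vec_of_list (map A (sorted_list_of_set (multi_indices qs)))"

definition outer_product ::
  "nat list \<Rightarrow> nat list \<Rightarrow> (nat list \<Rightarrow> real) \<Rightarrow> (nat list \<Rightarrow> real) \<Rightarrow> nat list \<Rightarrow> real" where
  "outer_product ms ns B C =
    (\<lambda>ks \<in> multi_indices (ms @ ns). B (take (length ms) ks) * C (drop (length ms) ks))"

text \<open>Kronecker product of column vectors: the \<open>i\<close>-th block of length \<open>dim_vec z\<close> is
  \<open>y $ i\<close> times \<open>z\<close> (indices of \<^typ>\<open>'a vec\<close> start at 0).\<close>

definition kronecker_vec :: "real vec \<Rightarrow> real vec \<Rightarrow> real vec" where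
  "kronecker_vec y z =
    vec (dim_vec y * dim_vec z) (\<lambda>k. y $ (k div dim_vec z) * z $ (k mod dim_vec z))"

definition decomposable :: "nat \<Rightarrow> nat \<Rightarrow> real vec \<Rightarrow> bool" where
  "decomposable m n v \<longleftrightarrow>
    (\<exists>y \<in> carrier_vec m. \<exists>z \<in> carrier_vec n. v = kronecker_vec y z)"

lemma multi_indices_Nil [simp]: "multi_indices [] = {[]}"
  by (simp add: multi_indices_def)

lemma multi_indices_Cons:
  "multi_indices (q # qs) = (\<lambda>(k, ks). k # ks) ` ({1..q} \<times> multi_indices qs)"
  by (auto simp: multi_indices_def set_Cons_def)

lemma finite_multi_indices [simp]: "finite (multi_indices qs)"
proof (induction qs)
  case (Cons q qs)
  then show ?case
    unfolding multi_indices_Cons by (intro finite_imageI finite_cartesian_product) auto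
qed simp

lemma card_multi_indices: "card (multi_indices qs) = prod_list qs"
proof (induction qs)
  case (Cons q qs)
  have inj: "inj_on (\<lambda>(k, ks). k # ks) ({1..q} \<times> multi_indices qs)"
    by (auto simp: inj_on_def)
  show ?case
    unfolding multi_indices_Cons card_image[OF inj] card_cartesian_product Cons.IH by simp
qed simp

lemma vector_form_carrier: "vector_form qs A \<in> carrier_vec (prod_list qs)"
  unfolding vector_form_def
  by (rule carrier_vecI) (simp only: dim_vec_of_list length_map length_sorted_list_of_set card_multi_indices)

end

theory Submission
  imports Defs
begin

text \<open>Vector form is a bijection from hypermatrices of a given format onto vectors, and it turns
  outer products into Kronecker products, because the lexicographic enumeration of the concatenated
  format runs through all pairs of indices with the second one varying fastest.\<close>

lemma length_multi_indices: "ks \<in> multi_indices qs \<Longrightarrow> length ks = length qs"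
  by (induction qs arbitrary: ks) (auto simp: multi_indices_Cons)

lemma multi_indices_append:
  "multi_indices (ms @ ns) = (\<lambda>(is, js). is @ js) ` (multi_indices ms \<times> multi_indices ns)"
proof (induction ms)
  case (Cons m ms)
  show ?case
  proof (intro equalityI subsetI)
    fix x assume "x \<in> multi_indices ((m # ms) @ ns)"
    then obtain k "is" js where mem: "k \<in> {1..m}" "is \<in> multi_indices ms" "js \<in> multi_indices ns"
      and x: "x = k # is @ js"
      by (auto simp: multi_indices_Cons Cons.IH)
    then have "k # is \<in> multi_indices (m # ms)"
      by (simp add: multi_indices_Cons image_iff)
    then show "x \<in> (\<lambda>(is, js). is @ js) ` (multi_indices (m # ms) \<times> multi_indices ns)"
      using mem x by (intro rev_image_eqI[of "(k # is, js)"]) simp_all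
  next
    fix x assume "x \<in> (\<lambda>(is, js). is @ js) ` (multi_indices (m # ms) \<times> multi_indices ns)"
    then obtain k "is" js where mem: "k \<in> {1..m}" "is \<in> multi_indices ms" "js \<in> multi_indices ns"
      and x: "x = k # is @ js"
      by (auto simp: multi_indices_Cons)
    then have "is @ js \<in> multi_indices (ms @ ns)"
      unfolding Cons.IH by (intro rev_image_eqI[of "(is, js)"]) simp_all
    then show "x \<in> multi_indices ((m # ms) @ ns)"
      using mem x by (simp add: multi_indices_Cons image_iff)
  qed
qed (simp add: image_def)

lemma list_less_append_left:
  "ys < zs \<Longrightarrow> xs @ ys < xs @ (zs :: 'a :: order list)"
  by (simp add: list_less_def lexord_append_leftI)

text \<open>Equal length excludes that \<open>xs\<close> is a proper prefix of \<open>ys\<close>, so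
  the comparison is decided at a position inside both and the suffixes cannot change it.\<close>

lemma list_less_append_same_length:
  "xs < ys \<Longrightarrow> length xs = length ys \<Longrightarrow> xs @ us < ys @ (vs :: 'a :: order list)"
  by (simp add: list_less_def lexord_sufI)

text \<open>\<open>List.product\<close> runs through \<open>ys\<close> once for each element of
  \<open>xs\<close>. Inside such a block the prefix is common and \<open>ys\<close> decides the
  order; between blocks the prefixes, all of length \<open>n\<close>, decide it.\<close>

lemma strict_sorted_map_append_product:
  fixes xs ys :: "'a :: linorder list list"
  assumes "sorted_wrt (<) xs" and "sorted_wrt (<) ys" and "\<forall>x \<in> set xs. length x = n"
  shows "sorted_wrt (<) (map (\<lambda>(x, y). x @ y) (List.product xs ys))"
  using assms(1,3)
proof (induction xs)
  case (Cons x xs)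
  have "sorted_wrt (<) (map ((@) x) ys)"
    using assms(2) by (auto simp: sorted_wrt_map list_less_append_left
        intro: sorted_wrt_mono_rel[of _ "(<)"])
  with Cons show ?case
    by (auto simp: sorted_wrt_append o_def intro!: list_less_append_same_length)
qed simp

text \<open>A strictly sorted list is determined by its set of elements, so it suffices that the
  right-hand side is strictly sorted and has the correct set.\<close>

lemma sorted_list_of_multi_indices_append:
  "sorted_list_of_set (multi_indices (ms @ ns)) =
    map (\<lambda>(is, js). is @ js)
      (List.product (sorted_list_of_set (multi_indices ms)) (sorted_list_of_set (multi_indices ns)))"
    (is "_ = ?L")
proof -
  have "sorted_wrt (<) ?L"
    by (rule strict_sorted_map_append_product[where n = "length ms"])
      (simp_all add: length_multi_indices)
  moreover have "set ?L = multi_indices (ms @ ns)"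
    by (simp add: multi_indices_append)
  ultimately show ?thesis
    by (metis sorted_list_of_set.idem_if_sorted_distinct strict_sorted_iff)
qed

lemma length_sorted_list_of_multi_indices:
  "length (sorted_list_of_set (multi_indices qs)) = prod_list qs"
  by (simp add: card_multi_indices)

lemma sorted_list_of_multi_indices_nth_in:
  "i < prod_list qs \<Longrightarrow> sorted_list_of_set (multi_indices qs) ! i \<in> multi_indices qs"
  by (metis finite_multi_indices length_sorted_list_of_multi_indices nth_mem set_sorted_list_of_set)

lemma vector_form_nth:
  "i < prod_list qs \<Longrightarrow>
    vector_form qs A $ i = A (sorted_list_of_set (multi_indices qs) ! i)"
  unfolding vector_form_def by (simp add: vec_of_list_index card_multi_indices)

lemma dim_vector_form [simp]: "dim_vec (vector_form qs A) = prod_list qs"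
  using vector_form_carrier by (rule carrier_vecD)

lemma bij_betw_vector_form:
  "bij_betw (vector_form qs) (hypermatrices qs) (carrier_vec (prod_list qs))"
proof -
  let ?L = "sorted_list_of_set (multi_indices qs)"
  \<comment> \<open>The enumeration is distinct, so 0-based positions correspond bijectively to
    multi-indices; injectivity and surjectivity both rest on this.\<close>
  have nth_bij: "bij_betw ((!) ?L) {..<prod_list qs} (multi_indices qs)"
    by (rule bij_betw_nth) (simp_all add: card_multi_indices)
  show ?thesis
  proof (rule bij_betw_imageI)
    show "inj_on (vector_form qs) (hypermatrices qs)"
    proof (rule inj_onI)
      fix A B
      assume A: "A \<in> hypermatrices qs" and B: "B \<in> hypermatrices qs"
        and eq: "vector_form qs A = vector_form qs B"
      show "A = B"
      proof (rule PiE_ext)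
        show "A \<in> multi_indices qs \<rightarrow>\<^sub>E UNIV" "B \<in> multi_indices qs \<rightarrow>\<^sub>E UNIV"
          using A B by (simp_all add: hypermatrices_def)
        fix ks assume "ks \<in> multi_indices qs"
        then obtain i where "i < prod_list qs" "ks = ?L ! i"
          using nth_bij by (auto simp: bij_betw_def)
        then show "A ks = B ks"
          using eq by (metis vector_form_nth)
      qed
    qed
    show "vector_form qs ` hypermatrices qs = carrier_vec (prod_list qs)"
    proof (intro equalityI subsetI)
      fix v :: "real vec" assume v: "v \<in> carrier_vec (prod_list qs)"
      \<comment> \<open>The preimage of \<open>v\<close> takes at \<open>ks\<close> the entry of
        \<open>v\<close> at the position of \<open>ks\<close> in the enumeration; the restricted
        abstraction makes it extensional.\<close>
      define A where
        "A = (\<lambda>ks \<in> multi_indices qs. v $ inv_into {..<prod_list qs} ((!) ?L) ks)"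
      have "vector_form qs A = v"
      proof (rule eq_vecI)
        fix i assume "i < dim_vec v"
        then have i: "i < prod_list qs" using v by simp
        then have "inv_into {..<prod_list qs} ((!) ?L) (?L ! i) = i"
          using nth_bij by (simp add: bij_betw_def)
        then show "vector_form qs A $ i = v $ i"
          using i by (simp add: vector_form_nth A_def sorted_list_of_multi_indices_nth_in)
      qed (use v in simp)
      moreover have "A \<in> hypermatrices qs"
        by (simp add: A_def hypermatrices_def)
      ultimately show "v \<in> vector_form qs ` hypermatrices qs" by blast
    qed (auto intro: vector_form_carrier)
  qed
qed

lemma outer_product_in_hypermatrices:
  "outer_product ms ns B C \<in> hypermatrices (ms @ ns)"
  by (simp add: outer_product_def hypermatrices_def)

text \<open>Position \<open>k\<close> of the product list holds the pair at positions
  \<open>k div n\<close> and \<open>k mod n\<close>, with \<open>n\<close> the length of the second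
  list. This is the index rule of \<open>kronecker_vec\<close>.\<close>

lemma vector_form_outer_product:
  "vector_form (ms @ ns) (outer_product ms ns B C) =
    kronecker_vec (vector_form ms B) (vector_form ns C)"
proof (rule eq_vecI)
  fix k assume "k < dim_vec (kronecker_vec (vector_form ms B) (vector_form ns C))"
  then have k: "k < prod_list ms * prod_list ns" by (simp add: kronecker_vec_def)
  \<comment> \<open>The existence of a position \<open>k\<close> below the product already forces
    the block length to be positive, so the remainder is a valid index.\<close>
  then have n: "0 < prod_list ns" by (cases "prod_list ns") auto
  have i: "k div prod_list ns < prod_list ms" using k by (simp add: less_mult_imp_div_less)
  have j: "k mod prod_list ns < prod_list ns" using n by simp
  let ?is = "sorted_list_of_set (multi_indices ms) ! (k div prod_list ns)"
  let ?js = "sorted_list_of_set (multi_indices ns) ! (k mod prod_list ns)"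
  have mem: "?is \<in> multi_indices ms" "?js \<in> multi_indices ns"
    using i j by (simp_all add: sorted_list_of_multi_indices_nth_in)
  then have "?is @ ?js \<in> multi_indices (ms @ ns)"
    by (auto simp: multi_indices_append)
  moreover have "sorted_list_of_set (multi_indices (ms @ ns)) ! k = ?is @ ?js"
    using k by (simp add: sorted_list_of_multi_indices_append product_nth card_multi_indices)
  \<comment> \<open>Since \<open>?is\<close> has the length of \<open>ms\<close>,
    \<open>take\<close> and \<open>drop\<close> in \<open>outer_product\<close> recover
    \<open>?is\<close> and \<open>?js\<close>.\<close>
  ultimately show "vector_form (ms @ ns) (outer_product ms ns B C) $ k =
      kronecker_vec (vector_form ms B) (vector_form ns C) $ k"
    using k i j mem
    by (simp add: vector_form_nth outer_product_def kronecker_vec_def length_multi_indices)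
qed (simp add: kronecker_vec_def)

theorem mainTheorem5:
  fixes r s :: nat and ms ns :: "nat list" and A :: "nat list \<Rightarrow> real"
  assumes "r \<ge> 1" and "s \<ge> 1"
    and "length ms = r" and "length ns = s"
    and "\<forall>m \<in> set ms. m > 0" and "\<forall>n \<in> set ns. n > 0"
    and "A \<in> hypermatrices (ms @ ns)"
  shows "(\<exists>B \<in> hypermatrices ms. \<exists>C \<in> hypermatrices ns. A = outer_product ms ns B C) \<longleftrightarrow>
    decomposable (prod_list ms) (prod_list ns) (vector_form (ms @ ns) A)"
proof -
  \<comment> \<open>Both sides are hypermatrices of the same format, where the vector form is
    injective.\<close>
  have "A = outer_product ms ns B C \<longleftrightarrow>
      vector_form (ms @ ns) A = kronecker_vec (vector_form ms B) (vector_form ns C)" for B C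
    using inj_on_eq_iff[OF bij_betw_imp_inj_on[OF bij_betw_vector_form] assms(7)
        outer_product_in_hypermatrices]
    by (simp add: vector_form_outer_product)
  \<comment> \<open>Surjectivity turns the quantifiers over \<open>y\<close> and \<open>z\<close> in
    \<open>decomposable\<close> into quantifiers over the hypermatrices \<open>B\<close> and
    \<open>C\<close>.\<close>
  moreover have "carrier_vec (prod_list qs) = vector_form qs ` hypermatrices qs" for qs
    using bij_betw_vector_form by (simp add: bij_betw_def)
  ultimately show ?thesis
    by (simp add: decomposable_def)
qed

end
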